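(* Let $(\mathbf{X},\mathbf{T})$ be a nonautonomous dynamical system, let $E\subset X_0$ be a Borel set, let $s\in\mathbb{R}$, let $\mu$ be a Borel probability measure on $X_0$ and let $\mathbf{f}\in\mathbf{C}(\mathbf{X},\mathbb{R})$. (1) If $\overline{P}_{\mu}(\mathbf{T},\mathbf{f},x)\le s$ for all $x\in E$, then $P^{\mathrm{P}}(\mathbf{T},\mathbf{f},E)\le s$. (2) If $\mathbf{f}$ is equicontinuous, $\overline{P}_{\mu}(\mathbf{T},\mathbf{f},x)\ge s$ for all $x\in E$, and $\mu(E)>0$, then $P^{\mathrm{P}}(\mathbf{T},\mathbf{f},E)\ge s$.
   Context: A nonautonomous dynamical system (NDS) $(\mathbf{X},\mathbf{T})$ consists of a sequence $\mathbf{X}=\{X_k\}_{k=0}^\infty$ of compact metric spaces $(X_k,d_k)$ and a sequence $\mathbf{T}=\{T_k\}_{k=0}^\infty$ of continuous maps $T_k:X_k\to X_{k+1}$. Put $\mathbf{T}^0=\mathrm{id}_{X_0}$ and $\mathbf{T}^j=T_{j-1}\circ\cdots\circ T_0:X_0\to X_j$. For $n\ge1$ and $x,y\in X_0$ let $d_n^{\mathbf{T}}(x,y)=\max_{0\le j\le n-1}d_j(\mathbf{T}^jx,\mathbf{T}^jy)$, and for $\varepsilon>0$ let $B_n^{\mathbf{T}}(x,\varepsilon)=\{y\in X_0:d_n^{\mathbf{T}}(x,y)<\varepsilon\}$ and $\overline{B}_n^{\mathbf{T}}(x,\varepsilon)=\{y\in X_0:d_n^{\mathbf{T}}(x,y)\le\varepsilon\}$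 (open and closed Bowen balls). $\mathbf{C}(\mathbf{X},\mathbb{R})=\prod_{k\ge0}C(X_k,\mathbb{R})$ is the set of sequences $\mathbf{f}=\{f_k\}_{k=0}^\infty$ of continuous functions $f_k:X_k\to\mathbb{R}$. $\mathbf{f}$ is equicontinuous if for every $\varepsilon>0$ there is $\delta>0$ such that for all $k\ge0$ and all $x',x''\in X_k$ with $d_k(x',x'')<\delta$ one has $|f_k(x')-f_k(x'')|<\varepsilon$. Put $S_n^{\mathbf{T}}\mathbf{f}=\sum_{j=0}^{n-1}f_j\circ\mathbf{T}^j$. Measure-theoretic upper local pressure: $\overline{P}_\mu(\mathbf{T},\mathbf{f},x)=\lim_{\varepsilon\to0}\limsup_{n\to\infty}\frac{-\log\mu(B_n^{\mathbf{T}}(x,\varepsilon))+S_n^{\mathbf{T}}\mathbf{f}(x)}{n}\in\mathbb{R}\cup\{\pm\infty\}$, with $\log0=-\infty$ (the inner quantity is non-increasing in $\varepsilon$, so the limit exists). Packing pressure: for $Z\subset X_0$, an $(N,\varepsilon)$-packing of $Z$ is a family of pairwise disjoint closed Bowen balls $\{\overline{B}_{n_i}^{\mathbf{T}}(x_i,\varepsilon)\}_i$ with $x_i\in Z$ and integers $n_i\ge N$. For $s\in\mathbb{R}$, $N>0$, $\varepsilon>0$ let $\mathscr{P}_{N,\varepsilon}^{s}(\mathbf{T},\mathbf{f},Z)=\sup\sum_i\exp(-n_is+S_{n_i}^{\mathbf{T}}\mathbf{f}(x_i))$, the supremum over all countable (finite or infinite) $(N,\varepsilon)$-packings of $Z$;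 $\mathscr{P}_{\infty,\varepsilon}^{s}(\mathbf{T},\mathbf{f},Z)=\lim_{N\to\infty}\mathscr{P}_{N,\varepsilon}^{s}(\mathbf{T},\mathbf{f},Z)$; $\mathscr{P}_{\varepsilon}^{s}(\mathbf{T},\mathbf{f},Z)=\inf\{\sum_{i=1}^\infty\mathscr{P}_{\infty,\varepsilon}^{s}(\mathbf{T},\mathbf{f},Z_i):\bigcup_{i=1}^\infty Z_i\supseteq Z\}$; $P^{\mathrm{P}}(\mathbf{T},\mathbf{f},Z,\varepsilon)=\inf\{s:\mathscr{P}_{\varepsilon}^{s}(\mathbf{T},\mathbf{f},Z)=0\}=\sup\{s:\mathscr{P}_{\varepsilon}^{s}(\mathbf{T},\mathbf{f},Z)=+\infty\}$. Then $P^{\mathrm{P}}(\mathbf{T},\mathbf{f},Z)=\lim_{\varepsilon\to0}P^{\mathrm{P}}(\mathbf{T},\mathbf{f},Z,\varepsilon)$ (monotone limit). *)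

theory Defs
  imports "HOL-Probability.Probability"
begin

text \<open>
  The spaces \<open>X\<^sub>k\<close> are values of type \<open>'a metric\<close>: carriers inside one common point type, each with
  its own metric. Since \<open>'a\<close> is arbitrary, this is no restriction (take a type into which the
  disjoint union of the spaces injects).
\<close>

definition is_nds :: "(nat \<Rightarrow> 'a metric) \<Rightarrow> (nat \<Rightarrow> 'a \<Rightarrow> 'a) \<Rightarrow> bool" where
  "is_nds X T \<longleftrightarrow>
     (\<forall>k. compact_space (mtopology_of (X k))) \<and>
     (\<forall>k. continuous_map (mtopology_of (X k)) (mtopology_of (X (Suc k))) (T k))"

primrec nds_iter :: "(nat \<Rightarrow> 'a \<Rightarrow> 'a) \<Rightarrow> nat \<Rightarrow> 'a \<Rightarrow> 'a" where
  "nds_iter T 0 = id"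
| "nds_iter T (Suc j) = T j \<circ> nds_iter T j"

text \<open>Only meaningful for \<open>n \<ge> 1\<close>; the value at \<open>n = 0\<close> never matters below.\<close>

definition bowen_dist ::
    "(nat \<Rightarrow> 'a metric) \<Rightarrow> (nat \<Rightarrow> 'a \<Rightarrow> 'a) \<Rightarrow> nat \<Rightarrow> 'a \<Rightarrow> 'a \<Rightarrow> real" where
  "bowen_dist X T n x y = Max ((\<lambda>j. mdist (X j) (nds_iter T j x) (nds_iter T j y)) ` {..<n})"

definition bowen_ball ::
    "(nat \<Rightarrow> 'a metric) \<Rightarrow> (nat \<Rightarrow> 'a \<Rightarrow> 'a) \<Rightarrow> nat \<Rightarrow> 'a \<Rightarrow> real \<Rightarrow> 'a set" where
  "bowen_ball X T n x \<epsilon> = {y \<in> mspace (X 0). bowen_dist X T n x y < \<epsilon>}"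

definition bowen_cball ::
    "(nat \<Rightarrow> 'a metric) \<Rightarrow> (nat \<Rightarrow> 'a \<Rightarrow> 'a) \<Rightarrow> nat \<Rightarrow> 'a \<Rightarrow> real \<Rightarrow> 'a set" where
  "bowen_cball X T n x \<epsilon> = {y \<in> mspace (X 0). bowen_dist X T n x y \<le> \<epsilon>}"

definition continuous_seq :: "(nat \<Rightarrow> 'a metric) \<Rightarrow> (nat \<Rightarrow> 'a \<Rightarrow> real) \<Rightarrow> bool" where
  "continuous_seq X f \<longleftrightarrow> (\<forall>k. continuous_map (mtopology_of (X k)) euclideanreal (f k))"

definition equicontinuous_seq :: "(nat \<Rightarrow> 'a metric) \<Rightarrow> (nat \<Rightarrow> 'a \<Rightarrow> real) \<Rightarrow> bool" where
  "equicontinuous_seq X f \<longleftrightarrow>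
     (\<forall>\<epsilon>>0. \<exists>\<delta>>0. \<forall>k. \<forall>x\<in>mspace (X k). \<forall>y\<in>mspace (X k).
        mdist (X k) x y < \<delta> \<longrightarrow> \<bar>f k x - f k y\<bar> < \<epsilon>)"

definition birkhoff_sum ::
    "(nat \<Rightarrow> 'a \<Rightarrow> 'a) \<Rightarrow> (nat \<Rightarrow> 'a \<Rightarrow> real) \<Rightarrow> nat \<Rightarrow> 'a \<Rightarrow> real" where
  "birkhoff_sum T f n x = (\<Sum>j<n. f j (nds_iter T j x))"

definition borel_of :: "'b topology \<Rightarrow> 'b measure" where
  "borel_of U = sigma (topspace U) {A. openin U A}"

text \<open>The library's real logarithm has \<open>ln 0 = 0\<close>, whereas here \<open>log 0 = -\<infinity>\<close>.\<close>

definition log_ereal :: "real \<Rightarrow> ereal" where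
  "log_ereal p = (if p = 0 then -\<infinity> else ereal (ln p))"

definition upper_local_pressure ::
    "(nat \<Rightarrow> 'a metric) \<Rightarrow> (nat \<Rightarrow> 'a \<Rightarrow> 'a) \<Rightarrow> (nat \<Rightarrow> 'a \<Rightarrow> real) \<Rightarrow> 'a measure \<Rightarrow> 'a \<Rightarrow> ereal"
  where
  "upper_local_pressure X T f \<mu> x =
     Lim (at_right 0) (\<lambda>\<epsilon>::real. limsup (\<lambda>n.
       (- log_ereal (measure \<mu> (bowen_ball X T n x \<epsilon>)) + ereal (birkhoff_sum T f n x))
         / ereal (real n)))"

text \<open>Packings are families indexed by a set \<open>I\<close> of naturals, finite or infinite (possibly empty).\<close>

definition is_packing ::
    "(nat \<Rightarrow> 'a metric) \<Rightarrow> (nat \<Rightarrow> 'a \<Rightarrow> 'a) \<Rightarrow> nat \<Rightarrow> real \<Rightarrow> 'a set \<Rightarrow>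
     nat set \<Rightarrow> (nat \<Rightarrow> 'a) \<Rightarrow> (nat \<Rightarrow> nat) \<Rightarrow> bool" where
  "is_packing X T N \<epsilon> Z I x n \<longleftrightarrow>
     (\<forall>i\<in>I. x i \<in> Z \<and> N \<le> n i) \<and>
     disjoint_family_on (\<lambda>i. bowen_cball X T (n i) (x i) \<epsilon>) I"

definition packing_pre ::
    "(nat \<Rightarrow> 'a metric) \<Rightarrow> (nat \<Rightarrow> 'a \<Rightarrow> 'a) \<Rightarrow> (nat \<Rightarrow> 'a \<Rightarrow> real) \<Rightarrow>
     real \<Rightarrow> nat \<Rightarrow> real \<Rightarrow> 'a set \<Rightarrow> ennreal" where
  "packing_pre X T f s N \<epsilon> Z =
     Sup {(\<Sum>\<^sub>\<infinity>i\<in>I. ennreal (exp (- real (n i) * s + birkhoff_sum T f (n i) (x i)))) | I x n.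
            is_packing X T N \<epsilon> Z I x n}"

definition packing_lim ::
    "(nat \<Rightarrow> 'a metric) \<Rightarrow> (nat \<Rightarrow> 'a \<Rightarrow> 'a) \<Rightarrow> (nat \<Rightarrow> 'a \<Rightarrow> real) \<Rightarrow>
     real \<Rightarrow> real \<Rightarrow> 'a set \<Rightarrow> ennreal" where
  "packing_lim X T f s \<epsilon> Z = lim (\<lambda>N. packing_pre X T f s N \<epsilon> Z)"

definition packing_measure ::
    "(nat \<Rightarrow> 'a metric) \<Rightarrow> (nat \<Rightarrow> 'a \<Rightarrow> 'a) \<Rightarrow> (nat \<Rightarrow> 'a \<Rightarrow> real) \<Rightarrow>
     real \<Rightarrow> real \<Rightarrow> 'a set \<Rightarrow> ennreal" where
  "packing_measure X T f s \<epsilon> Z =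
     Inf {(\<Sum>i. packing_lim X T f s \<epsilon> (W i)) | W :: nat \<Rightarrow> 'a set.
            (\<forall>i. W i \<subseteq> mspace (X 0)) \<and> Z \<subseteq> (\<Union>i. W i)}"

definition packing_pressure_eps ::
    "(nat \<Rightarrow> 'a metric) \<Rightarrow> (nat \<Rightarrow> 'a \<Rightarrow> 'a) \<Rightarrow> (nat \<Rightarrow> 'a \<Rightarrow> real) \<Rightarrow>
     'a set \<Rightarrow> real \<Rightarrow> ereal" where
  "packing_pressure_eps X T f Z \<epsilon> = Inf {ereal s | s. packing_measure X T f s \<epsilon> Z = 0}"

definition packing_pressure ::
    "(nat \<Rightarrow> 'a metric) \<Rightarrow> (nat \<Rightarrow> 'a \<Rightarrow> 'a) \<Rightarrow> (nat \<Rightarrow> 'a \<Rightarrow> real) \<Rightarrow> 'a set \<Rightarrow> ereal" where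
  "packing_pressure X T f Z = Lim (at_right 0) (packing_pressure_eps X T f Z)"

end

theory Submission
  imports Defs "HOL-Real_Asymp.Real_Asymp"
begin

text \<open>
  Both parts compare packing sums with \<open>\<mu>\<close>-measures of Bowen balls on sets where the limsup defining the
  local pressure has been made uniform.

  For (1), on the points whose balls satisfy \<open>\<mu>(B\<^sub>n(x,\<epsilon>)) > exp (- n s' + S\<^sub>n f(x))\<close> for all \<open>n \<ge> m\<close>,
  disjointness bounds every packing sum at exponent \<open>s'\<close> by 1, so at a larger exponent the sums decay.

  For (2), suppose \<open>Z\<close> has finite packing sums at exponent \<open>\<sigma>\<close>, and each of its points satisfies
  \<open>\<mu>(B\<^sub>n(x,3\<epsilon>)) < exp (- n \<tau> + S\<^sub>n f(x))\<close> for infinitely many \<open>n\<close>, where \<open>\<tau> > \<sigma>\<close>. For each \<open>n\<close> take a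
  maximal packing of the corresponding part of \<open>Z\<close> by balls of the same length \<open>n\<close>. The enlarged balls
  cover that part and have total measure \<open>O(exp (- n (\<tau> - \<sigma>)))\<close>, so \<open>Z\<close> is null by Borel-Cantelli. All
  balls have the same length, so no covering lemma for variable lengths is needed.
\<close>

section \<open>Limits as \<epsilon> tends to 0, and logarithmic quotients\<close>

text \<open>If \<open>g b\<close> exceeds a level, so does \<open>g\<close> at every smaller
  positive argument. Both pressures are defined through \<open>Lim\<close>; this replaces the limit
  by a supremum, which is easier to bound.\<close>

lemma antimono_on_Lim_at_right_0:
  fixes g :: "real \<Rightarrow> ereal"
  assumes "\<And>a b. 0 < a \<Longrightarrow> a \<le> b \<Longrightarrow> g b \<le> g a"
  shows "Lim (at_right 0) g = (SUP \<epsilon>\<in>{0<..}. g \<epsilon>)"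
proof (rule tendsto_Lim)
  show "(g \<longlongrightarrow> (SUP \<epsilon>\<in>{0<..}. g \<epsilon>)) (at_right 0)"
  proof (rule order_tendstoI)
    fix a assume "a < (SUP \<epsilon>\<in>{0<..}. g \<epsilon>)"
    then obtain b where b: "b > 0" "a < g b" by (auto simp: less_SUP_iff)
    then show "eventually (\<lambda>\<epsilon>. a < g \<epsilon>) (at_right 0)"
      unfolding eventually_at_right_field
      by (intro exI[of _ b]) (auto intro: less_le_trans[OF _ assms])
  next
    fix a assume a: "(SUP \<epsilon>\<in>{0<..}. g \<epsilon>) < a"
    show "eventually (\<lambda>\<epsilon>. g \<epsilon> < a) (at_right 0)"
      unfolding eventually_at_right_field
      by (intro exI[of _ 1]) (auto intro!: le_less_trans[OF _ a] SUP_upper)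
  qed
qed simp

text \<open>Translates the extended-real quotient of the local pressure into an exponential bound on
  a ball measure. For \<open>p = 0\<close> the quotient is +infinity, so both sides fail.\<close>

lemma pressure_quotient_less_iff:
  assumes "n > 0" "p \<ge> 0"
  shows "(- log_ereal p + ereal b) / ereal (real n) < ereal s \<longleftrightarrow> exp (- real n * s + b) < p"
proof (cases "p = 0")
  case False
  with assms have "exp (- real n * s + b) < p \<longleftrightarrow> - real n * s + b < ln p"
    by (metis exp_less_cancel_iff exp_ln order_le_imp_less_or_eq)
  with False assms show ?thesis by (simp add: log_ereal_def field_simps)
qed (use assms in \<open>simp add: log_ereal_def\<close>)

text \<open>The reverse comparison; for \<open>p = 0\<close> both sides now hold.\<close>

lemma less_pressure_quotient_iff:
  assumes "n > 0" "p \<ge> 0"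
  shows "ereal s < (- log_ereal p + ereal b) / ereal (real n) \<longleftrightarrow> p < exp (- real n * s + b)"
proof (cases "p = 0")
  case False
  with assms have "p < exp (- real n * s + b) \<longleftrightarrow> ln p < - real n * s + b"
    by (metis exp_less_cancel_iff exp_ln order_le_imp_less_or_eq)
  with False assms show ?thesis by (simp add: log_ereal_def field_simps)
qed (use assms in \<open>simp add: log_ereal_def\<close>)

lemma log_ereal_mono: "0 \<le> p \<Longrightarrow> p \<le> q \<Longrightarrow> log_ereal p \<le> log_ereal q"
  by (auto simp: log_ereal_def)

section \<open>Bowen distances and Bowen balls\<close>

lemma bowen_dist_less_iff:
  "n > 0 \<Longrightarrow> bowen_dist X T n x y < r \<longleftrightarrow> (\<forall>j<n. mdist (X j) (nds_iter T j x) (nds_iter T j y) < r)"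
  unfolding bowen_dist_def by (subst Max_less_iff) auto

lemma bowen_dist_le_iff:
  "n > 0 \<Longrightarrow> bowen_dist X T n x y \<le> r \<longleftrightarrow> (\<forall>j<n. mdist (X j) (nds_iter T j x) (nds_iter T j y) \<le> r)"
  unfolding bowen_dist_def by (subst Max_le_iff) auto

lemma bowen_dist_commute: "bowen_dist X T n x y = bowen_dist X T n y x"
  by (simp add: bowen_dist_def mdist_commute)

lemma bowen_ball_mono: "r \<le> r' \<Longrightarrow> bowen_ball X T n x r \<subseteq> bowen_ball X T n x r'"
  by (auto simp: bowen_ball_def)

lemma bowen_cball_mono: "r \<le> r' \<Longrightarrow> bowen_cball X T n x r \<subseteq> bowen_cball X T n x r'"
  by (auto simp: bowen_cball_def)

lemma bowen_ball_subset_cball: "bowen_ball X T n x r \<subseteq> bowen_cball X T n x r"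
  by (auto simp: bowen_ball_def bowen_cball_def)

lemma disjoint_family_on_refine:
  assumes "disjoint_family_on B I" "J \<subseteq> I" "\<And>i. i \<in> J \<Longrightarrow> A i \<subseteq> B i"
  shows "disjoint_family_on A J"
  unfolding disjoint_family_on_def
proof (intro ballI impI)
  fix i j assume "i \<in> J" "j \<in> J" "i \<noteq> j"
  then have "B i \<inter> B j = {}" "A i \<subseteq> B i" "A j \<subseteq> B j"
    using assms by (auto simp: disjoint_family_on_def)
  then show "A i \<inter> A j = {}" by blast
qed

section \<open>Monotonicity of the packing quantities\<close>

lemma is_packing_antimono:
  assumes "is_packing X T N \<epsilon> Z I x n" "N' \<le> N" "\<epsilon>' \<le> \<epsilon>" "Z \<subseteq> Z'"
  shows "is_packing X T N' \<epsilon>' Z' I x n"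
  using assms(1,2,4) unfolding is_packing_def
  by (auto elim!: disjoint_family_on_refine intro: le_trans bowen_cball_mono[OF assms(3), THEN subsetD])

lemma packing_pre_mono:
  assumes "N' \<le> N" "\<epsilon>' \<le> \<epsilon>" "Z \<subseteq> Z'"
  shows "packing_pre X T f s N \<epsilon> Z \<le> packing_pre X T f s N' \<epsilon>' Z'"
  unfolding packing_pre_def by (rule Sup_subset_mono) (use is_packing_antimono assms in blast)

text \<open>Raising \<open>N\<close> leaves fewer packings, so the sequence decreases and converges
  to its infimum.\<close>

lemma packing_lim_eq_INF: "packing_lim X T f s \<epsilon> Z = (INF N. packing_pre X T f s N \<epsilon> Z)"
  unfolding packing_lim_def
  by (intro limI LIMSEQ_INF) (simp add: decseq_def packing_pre_mono)

lemma packing_lim_mono: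
  assumes "\<epsilon>' \<le> \<epsilon>" "Z \<subseteq> Z'"
  shows "packing_lim X T f s \<epsilon> Z \<le> packing_lim X T f s \<epsilon>' Z'"
  unfolding packing_lim_eq_INF by (intro INF_mono) (use assms packing_pre_mono in blast)

lemma packing_measure_antimono:
  assumes "\<epsilon>' \<le> \<epsilon>"
  shows "packing_measure X T f s \<epsilon> Z \<le> packing_measure X T f s \<epsilon>' Z"
  unfolding packing_measure_def
proof (rule Inf_mono)
  fix b assume "b \<in> {(\<Sum>i. packing_lim X T f s \<epsilon>' (W i)) | W. (\<forall>i. W i \<subseteq> mspace (X 0)) \<and> Z \<subseteq> (\<Union>i. W i)}"
  then obtain W where W: "\<forall>i. W i \<subseteq> mspace (X 0)" "Z \<subseteq> (\<Union>i. W i)"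
    and b: "b = (\<Sum>i. packing_lim X T f s \<epsilon>' (W i))" by blast
  have "(\<Sum>i. packing_lim X T f s \<epsilon> (W i)) \<le> b"
    unfolding b by (intro suminf_le summableI packing_lim_mono assms order_refl)
  with W show "\<exists>a\<in>{(\<Sum>i. packing_lim X T f s \<epsilon> (W i)) | W. (\<forall>i. W i \<subseteq> mspace (X 0)) \<and> Z \<subseteq> (\<Union>i. W i)}. a \<le> b"
    by blast
qed

text \<open>Shrinking \<epsilon> can only increase the packing measure, so fewer exponents give
  measure 0 and their infimum rises.\<close>

lemma packing_pressure_eq_SUP:
  "packing_pressure X T f Z = (SUP \<epsilon>\<in>{0<..}. packing_pressure_eps X T f Z \<epsilon>)"
  unfolding packing_pressure_def
proof (rule antimono_on_Lim_at_right_0)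
  fix a b :: real assume ab: "0 < a" "a \<le> b"
  have "packing_measure X T f s b Z = 0" if "packing_measure X T f s a Z = 0" for s
    using packing_measure_antimono[OF ab(2), of X T f s Z] that by simp
  then show "packing_pressure_eps X T f Z b \<le> packing_pressure_eps X T f Z a"
    unfolding packing_pressure_eps_def by (intro Inf_superset_mono) blast
qed

section \<open>Topology and measurability of Bowen balls under a Borel probability measure\<close>

locale nds_prob = prob_space \<mu> for \<mu> :: "'a measure" +
  fixes X :: "nat \<Rightarrow> 'a metric" and T :: "nat \<Rightarrow> 'a \<Rightarrow> 'a"
  assumes nds: "is_nds X T"
    and sets_eq: "sets \<mu> = sets (borel_of (mtopology_of (X 0)))"
begin

lemma continuous_nds_iter: "continuous_map (mtopology_of (X 0)) (mtopology_of (X j)) (nds_iter T j)"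
proof (induction j)
  case (Suc j)
  with nds show ?case unfolding nds_iter.simps by (intro continuous_map_compose) (auto simp: is_nds_def)
qed (simp add: id_def)

lemma nds_iter_in_mspace: "x \<in> mspace (X 0) \<Longrightarrow> nds_iter T j x \<in> mspace (X j)"
  using continuous_nds_iter[of j] by (auto simp: continuous_map_def)

lemma bowen_dist_triangle:
  assumes "n > 0" "x \<in> mspace (X 0)" "y \<in> mspace (X 0)" "z \<in> mspace (X 0)"
    "bowen_dist X T n x y \<le> a" "bowen_dist X T n y z \<le> b"
  shows "bowen_dist X T n x z \<le> a + b"
  unfolding bowen_dist_le_iff[OF assms(1)]
proof (intro allI impI)
  fix j assume "j < n"
  then have "mdist (X j) (nds_iter T j x) (nds_iter T j y) \<le> a"
    "mdist (X j) (nds_iter T j y) (nds_iter T j z) \<le> b"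
    using assms(5,6) unfolding bowen_dist_le_iff[OF assms(1)] by auto
  then show "mdist (X j) (nds_iter T j x) (nds_iter T j z) \<le> a + b"
    using mdist_triangle[OF nds_iter_in_mspace nds_iter_in_mspace nds_iter_in_mspace] assms(2-4)
    by (meson add_mono order_trans)
qed

lemma centre_in_bowen_ball:
  assumes "n > 0" "x \<in> mspace (X 0)" "r > 0"
  shows "x \<in> bowen_ball X T n x r"
proof -
  have "mdist (X j) (nds_iter T j x) (nds_iter T j x) = 0" for j
    using nds_iter_in_mspace[OF assms(2)] by simp
  with assms show ?thesis by (simp add: bowen_ball_def bowen_dist_less_iff)
qed

text \<open>The ball is a finite intersection of preimages of metric balls under the continuous
  iterates.\<close>

lemma openin_bowen_ball:
  assumes "n > 0" "x \<in> mspace (X 0)"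
  shows "openin (mtopology_of (X 0)) (bowen_ball X T n x r)"
proof -
  have "openin (mtopology_of (X 0))
      {y \<in> topspace (mtopology_of (X 0)). nds_iter T j y \<in> mball_of (X j) (nds_iter T j x) r}" for j
    by (rule openin_continuous_map_preimage[OF continuous_nds_iter])
      (simp add: mball_of_def mtopology_of_def Metric_space.openin_mball)
  then have "openin (mtopology_of (X 0))
      (\<Inter>j\<in>{..<n}. {y \<in> topspace (mtopology_of (X 0)). nds_iter T j y \<in> mball_of (X j) (nds_iter T j x) r})"
    \<comment> \<open>Since \<open>n > 0\<close>, the family being intersected is nonempty.\<close>
    using assms by (intro openin_Inter) auto
  also have "(\<Inter>j\<in>{..<n}. {y \<in> topspace (mtopology_of (X 0)). nds_iter T j y \<in> mball_of (X j) (nds_iter T j x) r})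
      = bowen_ball X T n x r"
    using assms nds_iter_in_mspace by (auto simp: bowen_ball_def bowen_dist_less_iff)
  finally show ?thesis .
qed

lemma bowen_ball_sets:
  assumes "n > 0" "x \<in> mspace (X 0)"
  shows "bowen_ball X T n x r \<in> sets \<mu>"
proof -
  have "{A. openin (mtopology_of (X 0)) A} \<subseteq> Pow (topspace (mtopology_of (X 0)))"
    using openin_subset by blast
  then show ?thesis
    using openin_bowen_ball[OF assms] by (simp add: sets_eq borel_of_def)
qed

text \<open>Compactness bounds the size of disjoint families of closed balls of length
  \<open>n\<close>, so one of greatest cardinality exists. A point of \<open>Z\<close> missed by the
  tripled balls could be added to it as a further centre.\<close>

lemma maximal_disjoint_bowen_cballs:
  assumes n: "n > 0" and \<epsilon>: "\<epsilon> > 0" and Z: "Z \<subseteq> mspace (X 0)"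
  obtains F where "finite F" "F \<subseteq> Z" "disjoint_family_on (\<lambda>a. bowen_cball X T n a \<epsilon>) F"
    "Z \<subseteq> (\<Union>a\<in>F. bowen_ball X T n a (3 * \<epsilon>))"
proof -
  have "compactin (mtopology_of (X 0)) (mspace (X 0))"
    using nds by (simp add: is_nds_def compact_space_def)
  moreover have "openin (mtopology_of (X 0)) U" if "U \<in> (\<lambda>c. bowen_ball X T n c \<epsilon>) ` mspace (X 0)" for U
    using that openin_bowen_ball[OF n] by auto
  moreover have "mspace (X 0) \<subseteq> \<Union> ((\<lambda>c. bowen_ball X T n c \<epsilon>) ` mspace (X 0))"
    using centre_in_bowen_ball[OF n _ \<epsilon>] by auto
  ultimately obtain \<F> where "finite \<F>" "\<F> \<subseteq> (\<lambda>c. bowen_ball X T n c \<epsilon>) ` mspace (X 0)"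
    "mspace (X 0) \<subseteq> \<Union>\<F>"
    using compactinD by metis
  then obtain C where C: "finite C" "C \<subseteq> mspace (X 0)" "mspace (X 0) \<subseteq> (\<Union>c\<in>C. bowen_ball X T n c \<epsilon>)"
    by (metis finite_subset_image)
  define P where "P F \<longleftrightarrow> F \<subseteq> Z \<and> disjoint_family_on (\<lambda>a. bowen_cball X T n a \<epsilon>) F" for F
  \<comment> \<open>Each centre is sent to some \<open>c\<close> in the finite cover
    \<open>C\<close> whose ball contains it. That \<open>c\<close> lies in the closed ball around
    the centre, so disjointness makes the choice injective.\<close>
  have bound: "finite F \<and> card F \<le> card C" if "P F" for F
  proof -
    have "\<forall>y\<in>F. \<exists>c\<in>C. y \<in> bowen_ball X T n c \<epsilon>"
      using that C(3) Z unfolding P_def by blast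
    then obtain g where g: "\<And>y. y \<in> F \<Longrightarrow> g y \<in> C \<and> y \<in> bowen_ball X T n (g y) \<epsilon>" by metis
    have "g y \<in> bowen_cball X T n y \<epsilon>" if "y \<in> F" for y
      using g[OF that] C(2) by (auto simp: bowen_ball_def bowen_cball_def bowen_dist_commute)
    then have "inj_on g F"
      using that unfolding inj_on_def P_def disjoint_family_on_def by (metis disjoint_iff)
    moreover have "g ` F \<subseteq> C" using g by auto
    ultimately show ?thesis using C(1) by (meson inj_on_finite card_inj_on_le)
  qed
  have "P {}" by (simp add: P_def disjoint_family_on_def)
  then obtain F where F: "P F" "\<And>G. P G \<Longrightarrow> card G \<le> card F"
    using ex_has_greatest_nat[of P "{}" card "Suc (card C)"] bound by (auto simp: less_Suc_eq_le)
  have "y \<in> (\<Union>a\<in>F. bowen_ball X T n a (3 * \<epsilon>))" if y: "y \<in> Z" for y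
  proof (rule ccontr)
    assume y': "y \<notin> (\<Union>a\<in>F. bowen_ball X T n a (3 * \<epsilon>))"
    have disj: "bowen_cball X T n a \<epsilon> \<inter> bowen_cball X T n y \<epsilon> = {}" if a: "a \<in> F" for a
    proof (rule ccontr)
      assume "bowen_cball X T n a \<epsilon> \<inter> bowen_cball X T n y \<epsilon> \<noteq> {}"
      then obtain z where "z \<in> mspace (X 0)" "bowen_dist X T n a z \<le> \<epsilon>" "bowen_dist X T n z y \<le> \<epsilon>"
        by (auto simp: bowen_cball_def bowen_dist_commute)
      \<comment> \<open>Meeting closed \<epsilon>-balls have centres at distance at most
        \<open>2 * \<epsilon>\<close>, which is strictly less than the radius
        \<open>3 * \<epsilon>\<close> of the open ball.\<close>
      then have "bowen_dist X T n a y \<le> \<epsilon> + \<epsilon>"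
        using a y Z F(1) by (intro bowen_dist_triangle[OF n, of a z y]) (auto simp: P_def)
      then show False using y' y a Z \<epsilon> by (auto simp: bowen_ball_def)
    qed
    have "y \<notin> F"
      using y' centre_in_bowen_ball[OF n, of y "3 * \<epsilon>"] y Z \<epsilon> by auto
    moreover have "P (insert y F)"
      using F(1) disj y unfolding P_def disjoint_family_on_def by (auto simp: Int_commute)
    ultimately show False using F(2)[of "insert y F"] bound[OF F(1)] by simp
  qed
  then show ?thesis using that[of F] F(1) bound[OF F(1)] unfolding P_def by blast
qed

lemma upper_local_pressure_eq_SUP:
  assumes x: "x \<in> mspace (X 0)"
  shows "upper_local_pressure X T f \<mu> x = (SUP \<epsilon>\<in>{0<..}. limsup (\<lambda>n.
       (- log_ereal (measure \<mu> (bowen_ball X T n x \<epsilon>)) + ereal (birkhoff_sum T f n x)) / ereal (real n)))"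
  unfolding upper_local_pressure_def
\<comment> \<open>The comparison starts at \<open>n = 1\<close>, because at \<open>n = 0\<close> the
  Bowen distance is a maximum over the empty set.\<close>
proof (rule antimono_on_Lim_at_right_0, rule Limsup_mono, rule eventually_sequentiallyI[of 1])
  fix a b :: real and n :: nat assume ab: "0 < a" "a \<le> b" and n: "1 \<le> n"
  have "log_ereal (measure \<mu> (bowen_ball X T n x a)) \<le> log_ereal (measure \<mu> (bowen_ball X T n x b))"
    using n x ab by (intro log_ereal_mono finite_measure_mono bowen_ball_mono bowen_ball_sets) auto
  then show "(- log_ereal (measure \<mu> (bowen_ball X T n x b)) + ereal (birkhoff_sum T f n x)) / ereal (real n)
    \<le> (- log_ereal (measure \<mu> (bowen_ball X T n x a)) + ereal (birkhoff_sum T f n x)) / ereal (real n)"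
    using n by (intro ereal_divide_right_mono add_right_mono) auto
qed

section \<open>Upper bound for the packing pressure\<close>

text \<open>Each weight at exponent \<open>s\<close> is at most
  \<open>exp (- real N * (s - \<tau>))\<close> times the measure of its ball. The balls are disjoint
  and \<open>\<mu>\<close> has total mass 1, so this factor bounds the whole sum.\<close>

lemma packing_lim_eq_0:
  assumes Z: "Z \<subseteq> mspace (X 0)" and "\<tau> < s"
    and ball: "\<And>x n. x \<in> Z \<Longrightarrow> n \<ge> m \<Longrightarrow>
      exp (- real n * \<tau> + birkhoff_sum T f n x) < measure \<mu> (bowen_ball X T n x \<epsilon>)"
  shows "packing_lim X T f s \<epsilon> Z = 0"
proof -
  have le: "packing_pre X T f s N \<epsilon> Z \<le> ennreal (exp (- real N * (s - \<tau>)))" if N: "N \<ge> max 1 m" for N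
    unfolding packing_pre_def
  proof (safe intro!: Sup_least)
    fix I x n assume pack: "is_packing X T N \<epsilon> Z I x n"
    have xn: "x i \<in> Z" "N \<le> n i" if "i \<in> I" for i
      using pack that by (auto simp: is_packing_def)
    show "(\<Sum>\<^sub>\<infinity>i\<in>I. ennreal (exp (- real (n i) * s + birkhoff_sum T f (n i) (x i))))
        \<le> ennreal (exp (- real N * (s - \<tau>)))"
    \<comment> \<open>A nonnegative infinite sum is the supremum of its finite subsums, so finite
      additivity of \<open>\<mu>\<close> is enough.\<close>
    proof (subst nonneg_infsum_complete, simp, safe intro!: SUP_least)
      fix J assume J: "finite J" "J \<subseteq> I"
      let ?B = "\<lambda>i. bowen_ball X T (n i) (x i) \<epsilon>"
      have "(\<Sum>i\<in>J. exp (- real (n i) * s + birkhoff_sum T f (n i) (x i)))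
          \<le> (\<Sum>i\<in>J. exp (- real N * (s - \<tau>)) * measure \<mu> (?B i))"
      proof (rule sum_mono)
        fix i assume "i \<in> J"
        with J xn N have i: "x i \<in> Z" "N \<le> n i" "m \<le> n i" by force+
        have "real N * (s - \<tau>) \<le> real (n i) * (s - \<tau>)"
          using i(2) \<open>\<tau> < s\<close> by (intro mult_right_mono) auto
        then have "exp (- real (n i) * s + birkhoff_sum T f (n i) (x i))
            \<le> exp (- real N * (s - \<tau>)) * exp (- real (n i) * \<tau> + birkhoff_sum T f (n i) (x i))"
          unfolding exp_add[symmetric] by (simp add: algebra_simps)
        also have "\<dots> \<le> exp (- real N * (s - \<tau>)) * measure \<mu> (?B i)"
          using ball[OF i(1,3)] by simp
        finally show "exp (- real (n i) * s + birkhoff_sum T f (n i) (x i))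
            \<le> exp (- real N * (s - \<tau>)) * measure \<mu> (?B i)" .
      qed
      also have "\<dots> = exp (- real N * (s - \<tau>)) * measure \<mu> (\<Union>i\<in>J. ?B i)"
      proof -
        \<comment> \<open>Packings have disjoint closed balls, and the open balls lie inside
          them.\<close>
        have "disjoint_family_on ?B J"
          using pack by (intro disjoint_family_on_refine[OF _ J(2) bowen_ball_subset_cball])
            (simp add: is_packing_def)
        moreover have "?B ` J \<subseteq> sets \<mu>"
          using J xn Z N by (force intro!: bowen_ball_sets)
        ultimately show ?thesis
          using J(1) by (simp add: finite_measure_finite_Union sum_distrib_left)
      qed
      also have "\<dots> \<le> exp (- real N * (s - \<tau>))" by simp
      finally show "(\<Sum>i\<in>J. ennreal (exp (- real (n i) * s + birkhoff_sum T f (n i) (x i))))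
          \<le> ennreal (exp (- real N * (s - \<tau>)))"
        by (simp add: sum_ennreal ennreal_leI)
    qed
  qed
  have "(\<lambda>N. exp (- real N * (s - \<tau>))) \<longlonglongrightarrow> 0"
    using \<open>\<tau> < s\<close> by real_asymp
  then have lim: "(\<lambda>N. ennreal (exp (- real N * (s - \<tau>)))) \<longlonglongrightarrow> 0"
    using tendsto_ennrealI by fastforce
  have le': "\<forall>\<^sub>F N in sequentially. packing_pre X T f s N \<epsilon> Z \<le> ennreal (exp (- real N * (s - \<tau>)))"
    using le by (rule eventually_sequentiallyI)
  have "(\<lambda>N. packing_pre X T f s N \<epsilon> Z) \<longlonglongrightarrow> 0"
    by (rule tendsto_sandwich[OF _ le' tendsto_const lim]) simp
  then show ?thesis unfolding packing_lim_def by (rule limI)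
qed

text \<open>For fixed \<epsilon>, \<open>E\<close> is a countable union of sets \<open>W m\<close>
  on which the lower bound for ball measures holds for all \<open>n \<ge> m\<close>; each
  contributes 0 to the packing measure.\<close>

lemma packing_pressure_le:
  assumes E: "E \<subseteq> mspace (X 0)"
    and le: "\<And>x. x \<in> E \<Longrightarrow> upper_local_pressure X T f \<mu> x \<le> ereal s"
  shows "packing_pressure X T f E \<le> ereal s"
  unfolding packing_pressure_eq_SUP
proof (safe intro!: SUP_least)
  fix \<epsilon> :: real assume \<epsilon>: "\<epsilon> > 0"
  show "packing_pressure_eps X T f E \<epsilon> \<le> ereal s"
  proof (rule ereal_le_epsilon2)
    fix \<delta> :: real assume \<delta>: "0 < \<delta>"
    \<comment> \<open>Strictly between \<open>s\<close> and \<open>s + \<delta>\<close>: the lower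
      gap makes the limsup bound strict, the upper gap makes the packing sums decay.\<close>
    define \<tau> where "\<tau> = s + \<delta> / 2"
    define W where "W m = {x \<in> E. \<forall>n\<ge>m. exp (- real n * \<tau> + birkhoff_sum T f n x)
      < measure \<mu> (bowen_ball X T n x \<epsilon>)}" for m
    have "x \<in> (\<Union>m. W m)" if x: "x \<in> E" for x
    proof -
      have "limsup (\<lambda>n. (- log_ereal (measure \<mu> (bowen_ball X T n x \<epsilon>)) + ereal (birkhoff_sum T f n x))
          / ereal (real n)) \<le> ereal s"
        using le[OF x] E x \<epsilon> by (auto simp: upper_local_pressure_eq_SUP SUP_le_iff)
      also have "\<dots> < ereal \<tau>" using \<delta> by (simp add: \<tau>_def)
      finally have "\<forall>\<^sub>F n in sequentially. (- log_ereal (measure \<mu> (bowen_ball X T n x \<epsilon>))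
          + ereal (birkhoff_sum T f n x)) / ereal (real n) < ereal \<tau>"
        by (rule Limsup_lessD)
      then obtain m where m: "\<And>n. n \<ge> m \<Longrightarrow> (- log_ereal (measure \<mu> (bowen_ball X T n x \<epsilon>))
          + ereal (birkhoff_sum T f n x)) / ereal (real n) < ereal \<tau>"
        unfolding eventually_sequentially by auto
      have "exp (- real n * \<tau> + birkhoff_sum T f n x) < measure \<mu> (bowen_ball X T n x \<epsilon>)"
        if "n \<ge> max 1 m" for n
        using m[of n] that pressure_quotient_less_iff[of n "measure \<mu> (bowen_ball X T n x \<epsilon>)"] by simp
      \<comment> \<open>The maximum with 1 excludes \<open>n = 0\<close>, where the quotient does
        not translate into the exponential bound.\<close>
      then have "x \<in> W (max 1 m)" using x unfolding W_def by blast
      then show ?thesis by blast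
    qed
    then have "E \<subseteq> (\<Union>m. W m)" by blast
    moreover have W: "W m \<subseteq> mspace (X 0)" for m using E by (auto simp: W_def)
    moreover have "(\<Sum>m. packing_lim X T f (s + \<delta>) \<epsilon> (W m)) = 0"
    proof -
      have "packing_lim X T f (s + \<delta>) \<epsilon> (W m) = 0" for m
        by (rule packing_lim_eq_0[OF W, where \<tau> = \<tau> and m = m]) (use \<delta> in \<open>auto simp: \<tau>_def W_def\<close>)
      then show ?thesis by simp
    qed
    ultimately have "packing_measure X T f (s + \<delta>) \<epsilon> E \<le> 0"
      unfolding packing_measure_def by (intro Inf_lower) force
    then show "packing_pressure_eps X T f E \<epsilon> \<le> ereal s + ereal \<delta>"
      unfolding packing_pressure_eps_def by (intro Inf_lower) auto
  qed
qed

section \<open>Lower bound for the packing pressure\<close>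

text \<open>A maximal family of disjoint balls of length \<open>n\<close> is itself an admissible
  packing, while the tripled balls cover \<open>Z\<close>. Comparing exponents \<tau> and
  \<open>s\<close> ball by ball produces the factor. The measurable \<open>U\<close> stands in for
  \<open>Z\<close>, which may fail to be measurable.\<close>

lemma packing_pre_bounds_measure:
  assumes n: "n \<ge> N" "n > 0" and \<epsilon>: "\<epsilon> > 0" and Z: "Z \<subseteq> mspace (X 0)"
    and ball: "\<And>x. x \<in> Z \<Longrightarrow>
      measure \<mu> (bowen_ball X T n x (3 * \<epsilon>)) < exp (- real n * \<tau> + birkhoff_sum T f n x)"
  obtains U where "U \<in> sets \<mu>" "Z \<subseteq> U"
    "emeasure \<mu> U \<le> ennreal (exp (- real n * (\<tau> - s))) * packing_pre X T f s N \<epsilon> Z"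
proof -
  from maximal_disjoint_bowen_cballs[OF n(2) \<epsilon> Z] obtain F where F: "finite F" "F \<subseteq> Z"
    "disjoint_family_on (\<lambda>a. bowen_cball X T n a \<epsilon>) F" "Z \<subseteq> (\<Union>a\<in>F. bowen_ball X T n a (3 * \<epsilon>))" by blast
  \<comment> \<open>Packings are indexed by naturals, so the finite set of centres is
    enumerated.\<close>
  obtain h where h: "bij_betw h {0..<card F} F" using ex_bij_betw_nat_finite[OF F(1)] by blast
  have hF: "h i \<in> F" if "i \<in> {0..<card F}" for i
    using h that by (auto simp: bij_betw_def)
  have "disjoint_family_on (\<lambda>i. bowen_cball X T n (h i) \<epsilon>) {0..<card F}"
    unfolding disjoint_family_on_def
  proof (intro ballI impI)
    fix i j assume "i \<in> {0..<card F}" "j \<in> {0..<card F}" "i \<noteq> j"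
    then have "h i \<noteq> h j" "h i \<in> F" "h j \<in> F"
      using h hF by (auto simp: bij_betw_def inj_on_def)
    then show "bowen_cball X T n (h i) \<epsilon> \<inter> bowen_cball X T n (h j) \<epsilon> = {}"
      using F(3) by (simp add: disjoint_family_on_def)
  qed
  then have "is_packing X T N \<epsilon> Z {0..<card F} h (\<lambda>_. n)"
    using hF F(2) n(1) by (auto simp: is_packing_def)
  then have "(\<Sum>\<^sub>\<infinity>i\<in>{0..<card F}. ennreal (exp (- real n * s + birkhoff_sum T f n (h i))))
      \<le> packing_pre X T f s N \<epsilon> Z"
    unfolding packing_pre_def
    by (intro Sup_upper CollectI exI[of _ "{0..<card F}"] exI[of _ h] exI[of _ "\<lambda>_. n"]) simp
  then have pre: "(\<Sum>a\<in>F. ennreal (exp (- real n * s + birkhoff_sum T f n a))) \<le> packing_pre X T f s N \<epsilon> Z"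
    using sum.reindex_bij_betw[OF h, of "\<lambda>a. ennreal (exp (- real n * s + birkhoff_sum T f n a))"] by simp
  have sets: "bowen_ball X T n a (3 * \<epsilon>) \<in> sets \<mu>" if "a \<in> F" for a
    using that F(2) Z n by (intro bowen_ball_sets) auto
  have "emeasure \<mu> (\<Union>a\<in>F. bowen_ball X T n a (3 * \<epsilon>)) \<le> (\<Sum>a\<in>F. emeasure \<mu> (bowen_ball X T n a (3 * \<epsilon>)))"
    using F(1) sets by (intro emeasure_subadditive_finite) auto
  also have "\<dots> \<le> (\<Sum>a\<in>F. ennreal (exp (- real n * (\<tau> - s))) * ennreal (exp (- real n * s + birkhoff_sum T f n a)))"
  proof (rule sum_mono)
    fix a assume "a \<in> F"
    then have "measure \<mu> (bowen_ball X T n a (3 * \<epsilon>)) \<le> exp (- real n * \<tau> + birkhoff_sum T f n a)"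
      using ball F(2) by (intro less_imp_le) auto
    also have "\<dots> = exp (- real n * (\<tau> - s)) * exp (- real n * s + birkhoff_sum T f n a)"
      unfolding exp_add[symmetric] by (simp add: algebra_simps)
    finally show "emeasure \<mu> (bowen_ball X T n a (3 * \<epsilon>))
        \<le> ennreal (exp (- real n * (\<tau> - s))) * ennreal (exp (- real n * s + birkhoff_sum T f n a))"
      by (simp add: emeasure_eq_measure ennreal_mult[symmetric] ennreal_leI)
  qed
  also have "\<dots> \<le> ennreal (exp (- real n * (\<tau> - s))) * packing_pre X T f s N \<epsilon> Z"
    unfolding sum_distrib_left[symmetric] by (intro mult_left_mono pre) simp
  finally have "emeasure \<mu> (\<Union>a\<in>F. bowen_ball X T n a (3 * \<epsilon>))
      \<le> ennreal (exp (- real n * (\<tau> - s))) * packing_pre X T f s N \<epsilon> Z" .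
  moreover have "(\<Union>a\<in>F. bowen_ball X T n a (3 * \<epsilon>)) \<in> sets \<mu>"
    using F(1) sets by (rule sets.finite_UN)
  ultimately show ?thesis using that F(4) by meson
qed

text \<open>From some \<open>N\<close> on, packing sums of \<open>Z\<close> stay below 1, so the
  part of \<open>Z\<close> with a small ball at time \<open>n\<close> has a measurable cover of
  measure at most \<open>exp (- real n * (\<tau> - s))\<close>. These bounds are summable, and every
  point of \<open>Z\<close> lies in infinitely many covers.\<close>

lemma packing_lim_less_1_imp_null:
  assumes \<epsilon>: "\<epsilon> > 0" and Z: "Z \<subseteq> mspace (X 0)" and "s < \<tau>"
    and lim: "packing_lim X T f s \<epsilon> Z < 1"
    and freq: "\<And>x. x \<in> Z \<Longrightarrow> \<exists>\<^sub>F n in sequentially.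
      measure \<mu> (bowen_ball X T n x (3 * \<epsilon>)) < exp (- real n * \<tau> + birkhoff_sum T f n x)"
  shows "\<exists>U\<in>null_sets \<mu>. Z \<subseteq> U"
proof -
  from lim obtain N where N: "packing_pre X T f s N \<epsilon> Z < 1"
    unfolding packing_lim_eq_INF INF_less_iff by blast
  define Y where "Y n = {x \<in> Z. measure \<mu> (bowen_ball X T n x (3 * \<epsilon>))
    < exp (- real n * \<tau> + birkhoff_sum T f n x)}" for n
  have "\<exists>U\<in>sets \<mu>. Y n \<subseteq> U \<and> emeasure \<mu> U \<le> ennreal (exp (- real n * (\<tau> - s)))"
    if n: "n \<ge> max 1 N" for n
  proof -
    have YZ: "Y n \<subseteq> Z" by (auto simp: Y_def)
    obtain U where U: "U \<in> sets \<mu>" "Y n \<subseteq> U"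
      "emeasure \<mu> U \<le> ennreal (exp (- real n * (\<tau> - s))) * packing_pre X T f s N \<epsilon> (Y n)"
      by (rule packing_pre_bounds_measure[of N n \<epsilon> "Y n" \<tau> f s]) (use n \<epsilon> YZ Z in \<open>auto simp: Y_def\<close>)
    have "packing_pre X T f s N \<epsilon> (Y n) \<le> 1"
      using packing_pre_mono[OF order_refl order_refl YZ] N by (meson less_imp_le order_trans)
    then have "ennreal (exp (- real n * (\<tau> - s))) * packing_pre X T f s N \<epsilon> (Y n)
        \<le> ennreal (exp (- real n * (\<tau> - s))) * 1"
      by (rule mult_left_mono) simp
    then show ?thesis using U by (metis mult.right_neutral order_trans)
  qed
  then obtain U where U: "\<And>n. n \<ge> max 1 N \<Longrightarrow> U n \<in> sets \<mu> \<and> Y n \<subseteq> U n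
      \<and> emeasure \<mu> (U n) \<le> ennreal (exp (- real n * (\<tau> - s)))" by metis
  \<comment> \<open>Taking the empty set at early times makes measurability and the geometric bound
    hold for every \<open>n\<close>, without changing the limsup set.\<close>
  define V where "V n = (if n \<ge> max 1 N then U n else {})" for n
  have V: "V n \<in> sets \<mu>" for n using U by (auto simp: V_def)
  have "measure \<mu> (V n) \<le> exp (- (\<tau> - s)) ^ n" for n
  proof -
    have "measure \<mu> (U n) \<le> exp (- real n * (\<tau> - s))" if "n \<ge> max 1 N"
      using U[OF that] by (simp add: emeasure_eq_measure)
    then have "measure \<mu> (V n) \<le> exp (real n * - (\<tau> - s))" by (simp add: V_def algebra_simps)
    then show ?thesis by (simp only: exp_of_nat_mult)
  qed
  then have "summable (\<lambda>n. measure \<mu> (V n))"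
    using \<open>s < \<tau>\<close> by (intro summable_comparison_test'[OF summable_geometric[of "exp (- (\<tau> - s))"]]) auto
  then have "limsup V \<in> null_sets \<mu>"
    using V by (intro borel_cantelli_limsup1) (auto simp: emeasure_eq_measure)
  moreover have "Z \<subseteq> limsup V"
  proof
    fix x assume x: "x \<in> Z"
    have "\<exists>n\<ge>k. x \<in> V n" for k
    proof -
      obtain n where "n \<ge> max k (max 1 N)" "x \<in> Y n"
        using freq[OF x] x unfolding frequently_sequentially Y_def by blast
      then show ?thesis using U[of n] by (auto simp: V_def)
    qed
    then show "x \<in> limsup V" by (auto simp: limsup_INF_SUP)
  qed
  ultimately show ?thesis by blast
qed

text \<open>Some countable cover of \<open>E\<close> has total packing sum below 1, hence each piece
  does, and the previous result applies to its intersection with \<open>A\<close>.\<close>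

lemma packing_measure_eq_0_imp_null:
  assumes \<epsilon>: "\<epsilon> > 0" and A: "A \<subseteq> E" and "s < \<tau>"
    and zero: "packing_measure X T f s \<epsilon> E = 0"
    and freq: "\<And>x. x \<in> A \<Longrightarrow> \<exists>\<^sub>F n in sequentially.
      measure \<mu> (bowen_ball X T n x (3 * \<epsilon>)) < exp (- real n * \<tau> + birkhoff_sum T f n x)"
  shows "\<exists>U\<in>null_sets \<mu>. A \<subseteq> U"
proof -
  have "packing_measure X T f s \<epsilon> E < 1" using zero by simp
  then obtain W where W: "\<And>i. W i \<subseteq> mspace (X 0)" "E \<subseteq> (\<Union>i. W i)"
    and sum: "(\<Sum>i. packing_lim X T f s \<epsilon> (W i)) < 1"
    unfolding packing_measure_def Inf_less_iff by blast
  have "\<exists>U\<in>null_sets \<mu>. A \<inter> W i \<subseteq> U" for i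
  proof (rule packing_lim_less_1_imp_null[OF \<epsilon> _ \<open>s < \<tau>\<close>])
    have "packing_lim X T f s \<epsilon> (A \<inter> W i) \<le> packing_lim X T f s \<epsilon> (W i)"
      by (rule packing_lim_mono) auto
    also have "\<dots> \<le> (\<Sum>i. packing_lim X T f s \<epsilon> (W i))"
      using sum_le_suminf[OF summableI, of "{i}" "\<lambda>i. packing_lim X T f s \<epsilon> (W i)"] by simp
    finally show "packing_lim X T f s \<epsilon> (A \<inter> W i) < 1" using sum by simp
  qed (use W(1) freq in auto)
  then obtain U where U: "\<And>i. U i \<in> null_sets \<mu> \<and> A \<inter> W i \<subseteq> U i" by metis
  then have "(\<Union>i. U i) \<in> null_sets \<mu>" by (intro null_sets_UN) auto
  moreover have "A \<subseteq> (\<Union>i. U i)" using A W(2) U by blast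
  ultimately show ?thesis by blast
qed

text \<open>If the packing pressure were below \<open>s\<close>, then \<open>E\<close> would be a
  countable union of sets \<open>A k\<close>, one for each radius in a sequence tending to 0, each
  contained in a null set.\<close>

lemma packing_pressure_ge:
  assumes E: "E \<in> sets \<mu>" "E \<subseteq> mspace (X 0)" and pos: "measure \<mu> E > 0"
    and ge: "\<And>x. x \<in> E \<Longrightarrow> upper_local_pressure X T f \<mu> x \<ge> ereal s"
  shows "packing_pressure X T f E \<ge> ereal s"
proof (rule ccontr)
  assume "\<not> ?thesis"
  then obtain \<tau>' where \<tau>': "packing_pressure X T f E < ereal \<tau>'" "ereal \<tau>' < ereal s"
    using ereal_dense2 by (metis linorder_not_le)
  then obtain \<tau> where \<tau>: "\<tau>' < \<tau>" "\<tau> < s" using dense by auto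
  \<comment> \<open>The division by 3 makes the tripled radius equal to
    \<open>inverse (real (Suc k))\<close>. Since balls grow with the radius, these countably many
    radii are enough.\<close>
  define \<epsilon> where "\<epsilon> k = inverse (real (Suc k)) / 3" for k
  define A where "A k = {x \<in> E. \<exists>\<^sub>F n in sequentially.
    measure \<mu> (bowen_ball X T n x (3 * \<epsilon> k)) < exp (- real n * \<tau> + birkhoff_sum T f n x)}" for k
  have "\<exists>U\<in>null_sets \<mu>. A k \<subseteq> U" for k
  proof -
    have pos: "\<epsilon> k > 0" by (simp add: \<epsilon>_def)
    then have "packing_pressure_eps X T f E (\<epsilon> k) \<le> packing_pressure X T f E"
      unfolding packing_pressure_eq_SUP by (intro SUP_upper) auto
    \<comment> \<open>The infimum defining \<open>packing_pressure_eps\<close> is below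
      \<open>\<tau>'\<close>, so an exponent with packing measure 0 exists there. It may depend on
      \<open>k\<close>, but always stays below \<tau>.\<close>
    with \<tau>' obtain \<sigma> where "packing_measure X T f \<sigma> (\<epsilon> k) E = 0" "\<sigma> < \<tau>'"
      unfolding packing_pressure_eps_def by (auto simp: Inf_less_iff dest!: le_less_trans)
    then show ?thesis
      using \<tau> pos by (intro packing_measure_eq_0_imp_null[of "\<epsilon> k" "A k" E \<sigma> \<tau>]) (auto simp: A_def)
  qed
  then obtain U where U: "\<And>k. U k \<in> null_sets \<mu> \<and> A k \<subseteq> U k" by metis
  have "x \<in> (\<Union>k. A k)" if x: "x \<in> E" for x
  proof -
    let ?q = "\<lambda>r n. (- log_ereal (measure \<mu> (bowen_ball X T n x r)) + ereal (birkhoff_sum T f n x)) / ereal (real n)"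
    have "ereal \<tau> < ereal s" using \<tau>(2) by simp
    also have "\<dots> \<le> upper_local_pressure X T f \<mu> x" using ge[OF x] .
    also have "\<dots> = (SUP r\<in>{0<..}. limsup (?q r))"
      using x E(2) by (intro upper_local_pressure_eq_SUP) auto
    finally have "ereal \<tau> < (SUP r\<in>{0<..}. limsup (?q r))" .
    then obtain r where r: "r > 0" "ereal \<tau> < limsup (?q r)" by (auto simp: less_SUP_iff)
    from reals_Archimedean[OF r(1)] obtain k where k: "3 * \<epsilon> k < r" by (auto simp: \<epsilon>_def)
    have "\<exists>\<^sub>F n in sequentially. ereal \<tau> < ?q r n"
    proof (rule ccontr)
      assume "\<not> ?thesis"
      then have "\<forall>\<^sub>F n in sequentially. ?q r n \<le> ereal \<tau>" by (simp add: not_frequently not_less)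
      then have "limsup (?q r) \<le> ereal \<tau>" by (rule Limsup_bounded)
      with r(2) show False by simp
    qed
    moreover have "\<forall>\<^sub>F n in sequentially. ereal \<tau> < ?q r n \<longrightarrow>
        measure \<mu> (bowen_ball X T n x (3 * \<epsilon> k)) < exp (- real n * \<tau> + birkhoff_sum T f n x)"
    proof (rule eventually_sequentiallyI[of 1], rule impI)
      fix n :: nat assume n: "1 \<le> n" and q: "ereal \<tau> < ?q r n"
      have "measure \<mu> (bowen_ball X T n x (3 * \<epsilon> k)) \<le> measure \<mu> (bowen_ball X T n x r)"
        using n x E(2) k by (intro finite_measure_mono bowen_ball_mono bowen_ball_sets) auto
      also have "\<dots> < exp (- real n * \<tau> + birkhoff_sum T f n x)"
        using q n less_pressure_quotient_iff[of n "measure \<mu> (bowen_ball X T n x r)"] by simp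
      finally show "measure \<mu> (bowen_ball X T n x (3 * \<epsilon> k)) < exp (- real n * \<tau> + birkhoff_sum T f n x)" .
    qed
    ultimately have "x \<in> A k"
      using x unfolding A_def by (auto elim: frequently_rev_mp)
    then show ?thesis by blast
  qed
  then have "E \<subseteq> (\<Union>k. U k)" using U by blast
  moreover have "(\<Union>k. U k) \<in> null_sets \<mu>" using U by (intro null_sets_UN) auto
  \<comment> \<open>Measurability of \<open>E\<close> turns containment in a null set into being
    null.\<close>
  ultimately have "E \<in> null_sets \<mu>" using E(1) by (metis null_sets_subset)
  then show False using pos by (simp add: measure_eq_0_null_sets)
qed

end

theorem theorem2p9:
  fixes X :: "nat \<Rightarrow> 'a metric"
    and T :: "nat \<Rightarrow> 'a \<Rightarrow> 'a"
    and f :: "nat \<Rightarrow> 'a \<Rightarrow> real"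
    and \<mu> :: "'a measure"
    and E :: "'a set"
    and s :: real
  assumes "is_nds X T"
    and "E \<in> sets (borel_of (mtopology_of (X 0)))"
    and "prob_space \<mu>"
    and "sets \<mu> = sets (borel_of (mtopology_of (X 0)))"
    and "continuous_seq X f"
  shows "((\<forall>x\<in>E. upper_local_pressure X T f \<mu> x \<le> ereal s) \<longrightarrow>
            packing_pressure X T f E \<le> ereal s) \<and>
         (equicontinuous_seq X f \<and>
          (\<forall>x\<in>E. upper_local_pressure X T f \<mu> x \<ge> ereal s) \<and>
          measure \<mu> E > 0 \<longrightarrow>
            packing_pressure X T f E \<ge> ereal s)"
proof -
  interpret nds_prob \<mu> X T
    using assms by (simp add: nds_prob_def nds_prob_axioms_def)
  have "{A. openin (mtopology_of (X 0)) A} \<subseteq> Pow (topspace (mtopology_of (X 0)))"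
    using openin_subset by blast
  then have "E \<subseteq> mspace (X 0)"
    using sets.sets_into_space[OF assms(2)] by (simp add: borel_of_def)
  then show ?thesis
    using packing_pressure_le[where E = E and f = f and s = s] packing_pressure_ge[where E = E and f = f and s = s] assms(2,4) by blast
qed

end
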